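(* Let $F:\mathbb{R}^d\to\mathbb{R}^d$ be a (single-valued) cyclically quasi-monotone map of class $\mathscr{C}^1$ such that $F(x)\neq 0$ for every $x\in\mathbb{R}^d$. Then there exists a lower semi-continuous quasi-convex function $f:\mathbb{R}^d\to\mathbb{R}$ such that $F(x)\in \mathrm{N}f(x)$ for every $x\in\mathbb{R}^d$.
   Context: A map $F:\mathbb{R}^d\to\mathbb{R}^d$ is cyclically quasi-monotone if for every integer $N\ge 1$ and every finite sequence $x_0,\dots,x_N\in\mathbb{R}^d$ with $x_N=x_0$, one has $\min_{0\le i<N}(x_{i+1}-x_i)\cdot F(x_i)\le 0$. A function $f:\mathbb{R}^d\to\mathbb{R}$ is quasi-convex if $\{x: f(x)\le \ell\}$ is convex for every $\ell\in\mathbb{R}$. Its normal cone multi-map is $\mathrm{N}f(x)=\{p\in\mathbb{R}^d : \forall w\in\mathbb{R}^d,\ f(w)\le f(x)\implies p\cdot(w-x)\le 0\}$, i.e. the normal cone at $x$ to the convex set $\{w: f(w)\le f(x)\}$. *)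

theory Defs
  imports "HOL-Analysis.Analysis"
begin

(* Finite sequences x_0, ..., x_N are represented by functions on nat, of which only the
   values at 0, ..., N matter. *)
definition cyclically_quasi_monotone :: "('a::real_inner \<Rightarrow> 'a) \<Rightarrow> bool"
  where "cyclically_quasi_monotone F \<longleftrightarrow>
    (\<forall>N x. N \<ge> 1 \<longrightarrow> x N = x 0 \<longrightarrow>
      (MIN i\<in>{0..<N}. (x (Suc i) - x i) \<bullet> F (x i)) \<le> 0)"

definition quasi_convex :: "('a::real_vector \<Rightarrow> real) \<Rightarrow> bool"
  where "quasi_convex f \<longleftrightarrow> (\<forall>l. convex {x. f x \<le> l})"

definition level_normal_cone :: "('a::real_inner \<Rightarrow> real) \<Rightarrow> 'a \<Rightarrow> 'a set"
  where "level_normal_cone f x = {p. \<forall>w. f w \<le> f x \<longrightarrow> p \<bullet> (w - x) \<le> 0}"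

definition lower_semicontinuous :: "('a::topological_space \<Rightarrow> real) \<Rightarrow> bool"
  where "lower_semicontinuous f \<longleftrightarrow> (\<forall>x. \<forall>a < f x. eventually (\<lambda>y. a < f y) (nhds x))"

(* Continuity of the derivative F' is with respect to the operator norm. *)
definition C1_map :: "('a::real_normed_vector \<Rightarrow> 'b::real_normed_vector) \<Rightarrow> bool"
  where "C1_map F \<longleftrightarrow>
    (\<exists>F' :: 'a \<Rightarrow> 'a \<Rightarrow>\<^sub>L 'b.
      (\<forall>x. (F has_derivative blinfun_apply (F' x)) (at x)) \<and> continuous_on UNIV F')"

end

(* Write x < y when F x \<bullet> (y - x) > 0. Cyclic quasi-monotonicity says that the transitive closure T
   of this relation is irreflexive. Summing 2^(-n) over those points d_n of a dense sequence with
   T d_n x gives a strictly T-increasing function phi: if x < y, then by continuity of F the points z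
   with x < z < y form a nonempty open set, which contains some d_n. The set {w. \<not> T x w} is an
   intersection of closed half-spaces, so f w = sup {phi x | T x w} is lower semicontinuous and
   quasi-convex. Interpolating two points x < x' < y gives f x \<le> phi x < phi x' \<le> f y. *)
theory Submission
  imports Defs
begin

definition revealed :: "('a::real_inner \<Rightarrow> 'a) \<Rightarrow> 'a \<Rightarrow> 'a \<Rightarrow> bool"
  where "revealed F x y \<longleftrightarrow> 0 < F x \<bullet> (y - x)"

text \<open>A cycle of the relation, unrolled into a sequence \<open>g\<close>, is a closed sequence
  whose increments all have positive inner product with \<open>F\<close>, so the minimum over it
  would be positive.\<close>

lemma cyclically_quasi_monotone_irreflexive:
  assumes "cyclically_quasi_monotone F"
  shows "\<not> (revealed F)\<^sup>+\<^sup>+ x x"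
proof
  assume "(revealed F)\<^sup>+\<^sup>+ x x"
  then obtain n where "n > 0" "(revealed F ^^ n) x x"
    by (auto simp: tranclp_power)
  then obtain g where g: "g 0 = x" "g n = x" "\<And>i. i < n \<Longrightarrow> revealed F (g i) (g (Suc i))"
    by (auto simp: relpowp_fun_conv)
  have "(MIN i\<in>{0..<n}. (g (Suc i) - g i) \<bullet> F (g i)) \<le> 0"
    using assms \<open>n > 0\<close> g(1,2) unfolding cyclically_quasi_monotone_def by simp
  then obtain i where "i < n" "(g (Suc i) - g i) \<bullet> F (g i) \<le> 0"
    using \<open>n > 0\<close> by (subst (asm) Min_le_iff) auto
  with g(3)[of i] show False
    by (simp add: revealed_def inner_commute)
qed

text \<open>Take \<open>z\<close> on the segment from \<open>x\<close> to \<open>y\<close>, close to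
  \<open>x\<close>. By continuity \<open>F z\<close> still has positive inner product with
  \<open>y - x\<close>, and \<open>y - z\<close> is a positive multiple of
  \<open>y - x\<close>.\<close>

lemma revealed_interpolate:
  assumes "continuous_on UNIV F" "revealed F x y"
  obtains z where "revealed F x z" "revealed F z y"
proof -
  let ?z = "\<lambda>t. x + t *\<^sub>R (y - x)"
  have "isCont F x"
    using assms(1) by (simp add: continuous_on_eq_continuous_at)
  moreover have "(?z \<longlongrightarrow> x) (at_right (0::real))"
    by (auto intro!: tendsto_eq_intros)
  ultimately have "((\<lambda>t. F (?z t)) \<longlongrightarrow> F x) (at_right 0)"
    by (rule isCont_tendsto_compose)
  then have "((\<lambda>t. F (?z t) \<bullet> (y - x)) \<longlongrightarrow> F x \<bullet> (y - x)) (at_right 0)"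
    by (intro tendsto_intros)
  then have "\<forall>\<^sub>F t in at_right 0. 0 < F (?z t) \<bullet> (y - x)"
    using assms(2) by (auto simp: revealed_def intro: order_tendstoD)
  moreover have "\<forall>\<^sub>F t in at_right 0. t \<in> {0<..<1::real}"
    by (rule eventually_at_right_real) simp
  ultimately have "\<forall>\<^sub>F t in at_right 0. 0 < F (?z t) \<bullet> (y - x) \<and> t \<in> {0<..<1::real}"
    by eventually_elim simp
  then obtain t where t: "0 < F (?z t) \<bullet> (y - x)" "0 < t" "t < (1::real)"
    using eventually_happens' trivial_limit_at_right_real by fastforce
  have "y - ?z t = (1 - t) *\<^sub>R (y - x)"
    by (simp add: algebra_simps)
  then have "revealed F (?z t) y"
    using t by (simp add: revealed_def)
  moreover have "revealed F x (?z t)"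
    using t assms(2) by (simp add: revealed_def)
  ultimately show thesis
    using that by blast
qed

lemma open_revealed_right: "open {y. revealed F x y}"
  unfolding revealed_def by (intro open_Collect_less continuous_intros)

lemma open_revealed_left:
  assumes "continuous_on UNIV F"
  shows "open {x. revealed F x y}"
  unfolding revealed_def by (intro open_Collect_less continuous_intros assms)

text \<open>Splitting off the last step isolates the dependence on \<open>y\<close>: the points
  above \<open>x\<close> form a union of open half-spaces, one for each possible last
  \<open>z\<close>.\<close>

lemma tranclp_iff_rtranclp_step: "r\<^sup>+\<^sup>+ x y \<longleftrightarrow> (\<exists>z. r\<^sup>*\<^sup>* x z \<and> r z y)"
proof
  assume "r\<^sup>+\<^sup>+ x y"
  then show "\<exists>z. r\<^sup>*\<^sup>* x z \<and> r z y"
    by cases (auto dest: tranclp_into_rtranclp)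
qed (auto intro: rtranclp_into_tranclp1)

lemma open_tranclp_revealed: "open {y. (revealed F)\<^sup>+\<^sup>+ x y}"
proof -
  have "{y. (revealed F)\<^sup>+\<^sup>+ x y} = (\<Union>z\<in>{z. (revealed F)\<^sup>*\<^sup>* x z}. {y. revealed F z y})"
    by (auto simp: tranclp_iff_rtranclp_step)
  then show ?thesis
    by (auto intro: open_revealed_right)
qed

lemma convex_not_tranclp_revealed: "convex {y. \<not> (revealed F)\<^sup>+\<^sup>+ x y}"
proof -
  have "{y. \<not> (revealed F)\<^sup>+\<^sup>+ x y} = (\<Inter>z\<in>{z. (revealed F)\<^sup>*\<^sup>* x z}. {y. F z \<bullet> y \<le> F z \<bullet> z})"
    by (auto simp: tranclp_iff_rtranclp_step revealed_def inner_diff_right not_less)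
  then show ?thesis
    by (auto intro: convex_INT convex_halfspace_le)
qed

text \<open>The uniform bounds are needed later, to keep the supremum defining \<open>f\<close>
  finite and to make 0 a neutral default value.\<close>

lemma strictly_increasing_function_exists:
  fixes F :: "'a::{real_inner,second_countable_topology} \<Rightarrow> 'a"
  assumes "continuous_on UNIV F" and irrefl: "\<And>x. \<not> (revealed F)\<^sup>+\<^sup>+ x x"
  shows "\<exists>\<phi> :: 'a \<Rightarrow> real. (\<forall>x. 0 \<le> \<phi> x \<and> \<phi> x \<le> 2) \<and> (\<forall>x y. (revealed F)\<^sup>+\<^sup>+ x y \<longrightarrow> \<phi> x < \<phi> y)"
proof -
  let ?T = "(revealed F)\<^sup>+\<^sup>+"
  obtain D :: "'a set" where D: "countable D" "\<And>X. open X \<Longrightarrow> X \<noteq> {} \<Longrightarrow> \<exists>d\<in>D. d \<in> X"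
    using countable_dense_exists by metis
  \<comment> \<open>The enumeration may repeat points; it only matters that every point of
    \<open>D\<close> is some \<open>d n\<close>.\<close>
  define d where "d = from_nat_into D"
  define a where "a x n = (if ?T (d n) x then (1/2::real) ^ n else 0)" for x n
  have a_bounds: "0 \<le> a x n" "a x n \<le> (1/2) ^ n" for x n
    by (auto simp: a_def)
  have geo: "summable (\<lambda>n. (1/2::real) ^ n)"
    by (rule summable_geometric) simp
  have sm: "summable (a x)" for x
    by (rule summable_comparison_test'[OF geo]) (use a_bounds in auto)
  have strict: "suminf (a x) < suminf (a y)" if "revealed F x y" for x y
  proof -
    obtain z where "revealed F x z" "revealed F z y"
      by (rule revealed_interpolate[OF assms(1) \<open>revealed F x y\<close>])
    then have "{z. revealed F x z} \<inter> {z. revealed F z y} \<noteq> {}"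
      by blast
    from D(2)[OF open_Int[OF open_revealed_right open_revealed_left[OF assms(1)]] this]
    obtain e where "e \<in> D" "revealed F x e" "revealed F e y"
      by auto
    moreover obtain n where "d n = e"
      using from_nat_into_surj[OF D(1) \<open>e \<in> D\<close>] by (auto simp: d_def)
    \<comment> \<open>If \<open>d n\<close> were also below \<open>x\<close>, the step from
      \<open>x\<close> to \<open>d n\<close> would close a cycle. So term \<open>n\<close> is
      counted for \<open>y\<close> but not for \<open>x\<close>, while every term counted for
      \<open>x\<close> is counted for \<open>y\<close>.\<close>
    ultimately have n: "?T (d n) y" "\<not> ?T (d n) x"
      using irrefl[of x] tranclp_into_tranclp2[of "revealed F" x "d n" x] by auto
    have "0 < (\<Sum>k. a y k - a x k)"
    proof (rule suminf_pos2)
      show "summable (\<lambda>k. a y k - a x k)"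
        by (intro summable_diff sm)
      show "0 \<le> a y k - a x k" for k
        using tranclp.trancl_into_trancl[of "revealed F" "d k" x y] \<open>revealed F x y\<close> by (auto simp: a_def)
      show "0 < a y n - a x n"
        using n by (simp add: a_def)
    qed
    then show ?thesis
      by (simp add: suminf_diff[OF sm sm, symmetric])
  qed
  have nonneg: "0 \<le> suminf (a x)" for x
    by (intro suminf_nonneg sm a_bounds)
  have "suminf (a x) \<le> (\<Sum>n. (1/2) ^ n)" for x
    by (intro suminf_le sm geo a_bounds)
  then have le_2: "suminf (a x) \<le> 2" for x
    by (simp add: suminf_geometric)
  have "suminf (a x) < suminf (a y)" if "?T x y" for x y
    using that by (induction rule: tranclp_induct) (auto dest: strict)
  with nonneg le_2 show ?thesis
    by (intro exI[of _ "\<lambda>x. suminf (a x)"]) simp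
qed

lemma cyclically_quasi_monotone_potential:
  fixes F :: "'a::{real_inner,second_countable_topology} \<Rightarrow> 'a"
  assumes "cyclically_quasi_monotone F" and cont: "continuous_on UNIV F"
  shows "\<exists>f. lower_semicontinuous f \<and> quasi_convex f \<and> (\<forall>x. F x \<in> level_normal_cone f x)"
proof -
  let ?T = "(revealed F)\<^sup>+\<^sup>+"
  obtain \<phi> :: "'a \<Rightarrow> real" where \<phi>: "\<And>x. 0 \<le> \<phi> x" "\<And>x. \<phi> x \<le> 2" "\<And>x y. ?T x y \<Longrightarrow> \<phi> x < \<phi> y"
    using strictly_increasing_function_exists[OF cont cyclically_quasi_monotone_irreflexive[OF assms(1)]] by auto
  \<comment> \<open>Inserting 0 covers points \<open>w\<close> with nothing below them; elsewhere it
    changes nothing, since \<open>\<phi>\<close> is nonnegative.\<close>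
  define f where "f w = Sup (insert 0 (\<phi> ` {x. ?T x w}))" for w
  have bdd: "bdd_above (insert 0 (\<phi> ` {x. ?T x w}))" for w
    using \<phi>(2) by (auto intro!: bdd_aboveI2)
  have f_le_iff: "f w \<le> l \<longleftrightarrow> 0 \<le> l \<and> (\<forall>x. ?T x w \<longrightarrow> \<phi> x \<le> l)" for w l
    unfolding f_def by (subst cSup_le_iff[OF _ bdd]) auto
  have "lower_semicontinuous f"
    unfolding lower_semicontinuous_def
  proof (intro allI impI)
    fix x a assume "a < f x"
    then consider "a < 0" | z where "?T z x" "a < \<phi> z"
      using f_le_iff[of x a] by force
    then show "\<forall>\<^sub>F y in nhds x. a < f y"
    proof cases
      case 1
      then show ?thesis
        using f_le_iff by (intro always_eventually) (meson linorder_not_le)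
    next
      case 2
      have "\<forall>\<^sub>F y in nhds x. y \<in> {y. ?T z y}"
        using 2 by (intro eventually_nhds_in_open open_tranclp_revealed) simp
      then show ?thesis
        by eventually_elim (use 2 f_le_iff in \<open>meson linorder_not_le mem_Collect_eq\<close>)
    qed
  qed
  moreover have "quasi_convex f"
    unfolding quasi_convex_def
  proof
    fix l
    \<comment> \<open>A point \<open>w\<close> is in the sublevel set exactly when no
      \<open>x\<close> with \<open>\<phi> x > l\<close> lies below it; negative levels give the
      empty set because \<open>f\<close> is nonnegative.\<close>
    have "{w. f w \<le> l} = (if 0 \<le> l then \<Inter>x\<in>{x. l < \<phi> x}. {w. \<not> ?T x w} else {})"
      using f_le_iff[of _ l] by (auto simp: not_less[symmetric])
    then show "convex {w. f w \<le> l}"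
      by (auto intro: convex_INT convex_not_tranclp_revealed)
  qed
  moreover have "F x \<in> level_normal_cone f x" for x
  proof -
    \<comment> \<open>This is the contrapositive of the normal cone condition.\<close>
    have "f x < f w" if w: "revealed F x w" for w
    proof -
      \<comment> \<open>Using \<open>x\<close> itself in the supremum for \<open>f w\<close> would
        give only \<open>f x \<le> \<phi> x \<le> f w\<close>; the intermediate \<open>z\<close>
        makes the inequality strict.\<close>
      obtain z where z: "revealed F x z" "revealed F z w"
        by (rule revealed_interpolate[OF cont w])
      have "f x \<le> \<phi> x"
        using \<phi>(1,3) by (auto simp: f_le_iff less_imp_le)
      also have "\<phi> x < \<phi> z"
        using \<phi>(3) z(1) by blast
      also have "\<phi> z \<le> f w"
        using f_le_iff[of w "f w"] z(2) by blast
      finally show ?thesis .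
    qed
    then show ?thesis
      by (auto simp: level_normal_cone_def revealed_def simp flip: not_less)
  qed
  ultimately show ?thesis
    by blast
qed

theorem theorem4p5:
  fixes F :: "real ^ 'd \<Rightarrow> real ^ 'd"
  assumes "cyclically_quasi_monotone F"
    and "C1_map F"
    and "\<And>x. F x \<noteq> 0"
  shows "\<exists>f :: real ^ 'd \<Rightarrow> real.
    lower_semicontinuous f \<and> quasi_convex f \<and> (\<forall>x. F x \<in> level_normal_cone f x)"
proof -
  have "continuous_on UNIV F"
    using assms(2) by (auto simp: C1_map_def continuous_on_eq_continuous_at dest: has_derivative_continuous)
  with assms(1) show ?thesis
    by (rule cyclically_quasi_monotone_potential)
qed

end
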